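(* Let $\mathcal C\subset\mathbb{P}^{n-1}$ be the real polyhedral cone generated by $v^1,\dots,v^p\in\mathbb{R}^n$. For every non-redundant apex $a\in\mathcal A$ there exist a non-empty proper subset $I$ of $[n]$ and $j\in[n]\setminus I$ such that $a$ is an $(I,j)$-vertex of $\mathcal C$.
   Context: Max-plus semiring $\mathbb{R}_{\max}=\mathbb{R}\cup\{-\infty\}$ with $\oplus=\max$, $\otimes=+$; on $\mathbb{R}_{\max}^n$, componentwise maximum and $\lambda x=(\lambda+x_1,\dots,\lambda+x_n)$. $\mathcal C=\{\lambda_1v^1\oplus\dots\oplus\lambda_pv^p:\lambda_r\in\mathbb{R}_{\max}\}$, identified with its image in $\mathbb{P}^{n-1}=\mathbb{R}^n/\mathbb{R}(1,\dots,1)$ (usual topology; $\partial\mathcal C$ its boundary). For $b\in\mathbb{R}^n$ and non-empty proper $K\subsetneq[n]$, $\mathcal H(b,K)=\{x\in\mathbb{R}_{\max}^n\setminus\{(-\infty,\dots,-\infty)\}:\max_{i\in K}(x_i-b_i)\ge\max_{j\notin K}(x_j-b_j)\}$ (modulo constants), with apex $b$. $\Sigma$ is the set of all $\mathcal H(b,K)$ with $\mathcal C\subset\mathcal H(b,K)$ and $b\in\mathcal C$; $\tau(\Gamma)=\{\mathcal H\in\Sigma:\bigcap_{\mathcal H'\in\Gamma}\mathcal H'\subset\mathcal H\}$ ($\tau(\emptyset)=\emptyset$); $\Sigma_b=\{\mathcal H(b,K):\mathcal C\subset\mathcal H(b,K)\}$; $\tau'(X)=\{b\in\partial\mathcal C:\Sigma_b\subset\tau(\bigcup_{c\in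 X}\Sigma_c)\}$; the set $\mathcal A$ of non-redundant apices is the unique inclusion-minimal finite $X\subset\partial\mathcal C$ with $\tau'(X)=\partial\mathcal C$. The type of $x\in\mathbb{R}^n$ relative to $v^1,\dots,v^p$ is $(S_1(x),\dots,S_n(x))$ with $S_j(x)=\{r\in[p]:v^r_j-x_j\ge v^r_i-x_i\ \forall i\in[n]\}$. For non-empty proper $I\subsetneq[n]$ and $j\notin I$, $a\in\mathbb{P}^{n-1}$ is an $(I,j)$-vertex of $\mathcal C$ if: (C1) $\bigcup_{i\in I}S_i(a)=[p]$; (C2) for each $k\notin I$ there is $i\in I$ with $S_i(a)\cap S_k(a)\neq\emptyset$; (C4) for each $i\in I$, $S_i(a)\cap S_j(a)\not\subset\bigcup_{k\in I\setminus\{i\}}S_k(a)$. *)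

theory Defs
  imports "HOL-Analysis.Analysis"
begin

definition tproj_rel :: "real^'n \<Rightarrow> real^'n \<Rightarrow> bool" where
  "tproj_rel x y \<longleftrightarrow> (\<exists>c. \<forall>i. x $ i = c + y $ i)"

lemma equivp_tproj_rel: "equivp (tproj_rel :: real^'n \<Rightarrow> _)"
proof (rule equivpI)
  show "reflp (tproj_rel :: real^'n \<Rightarrow> _)"
    by (auto simp: reflp_def tproj_rel_def intro: exI[of _ 0])
  show "symp (tproj_rel :: real^'n \<Rightarrow> _)"
  proof (rule sympI)
    fix x y :: "real^'n" assume "tproj_rel x y"
    then obtain c where "\<And>i. x $ i = c + y $ i" by (auto simp: tproj_rel_def)
    then have "\<forall>i. y $ i = - c + x $ i" by simp
    then show "tproj_rel y x" unfolding tproj_rel_def by blast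
  qed
  show "transp (tproj_rel :: real^'n \<Rightarrow> _)"
  proof (rule transpI)
    fix x y z :: "real^'n" assume "tproj_rel x y" "tproj_rel y z"
    then obtain c d where "\<And>i. x $ i = c + y $ i" "\<And>i. y $ i = d + z $ i"
      by (auto simp: tproj_rel_def)
    then have "\<forall>i. x $ i = (c + d) + z $ i" by simp
    then show "tproj_rel x z" unfolding tproj_rel_def by blast
  qed
qed

quotient_type (overloaded) 'n tproj = "real^('n::finite)" / tproj_rel
  morphisms rep_proj to_proj
  by (rule equivp_tproj_rel)

lemma to_proj_eq_iff: "to_proj x = to_proj y \<longleftrightarrow> (\<exists>c. \<forall>i. x $ i = c + y $ i)"
  by (simp add: tproj.abs_eq_iff tproj_rel_def)

instantiation tproj :: (finite) topological_space
begin

definition open_tproj :: "'a tproj set \<Rightarrow> bool" where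
  "open_tproj U \<longleftrightarrow> open (to_proj -` U)"

instance
proof
  show "open (UNIV :: 'a tproj set)"
    by (simp add: open_tproj_def)
next
  fix S T :: "'a tproj set" assume "open S" "open T"
  then show "open (S \<inter> T)" by (simp add: open_tproj_def vimage_Int open_Int)
next
  fix \<K> :: "'a tproj set set" assume "\<forall>S\<in>\<K>. open S"
  then show "open (\<Union>\<K>)" by (auto simp: open_tproj_def vimage_Union)
qed

end

text \<open>
  The max-plus semiring is the set of extended reals other than \<open>\<infinity>\<close>, with
  tropical zero \<open>-\<infinity>\<close>.  Subsets of \<open>ereal^'n\<close> that are invariant under adding real
  constants stand for their images modulo constants.
\<close>

definition rmax_vecs :: "(ereal^'n) set" where
  "rmax_vecs = {x. \<forall>i. x $ i \<noteq> \<infinity>}"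

definition rmax_zero :: "ereal^'n" where
  "rmax_zero = (\<chi> i. - \<infinity>)"

definition real_to_rmax :: "real^'n \<Rightarrow> ereal^'n" where
  "real_to_rmax x = (\<chi> i. ereal (x $ i))"

definition mp_cone :: "(nat \<Rightarrow> real^'n) \<Rightarrow> nat \<Rightarrow> (ereal^'n) set" where
  "mp_cone v p = {(\<chi> i. SUP r\<in>{1..p}. l r + ereal (v r $ i)) |l. \<forall>r\<in>{1..p}. l r \<noteq> \<infinity>}"

text \<open>Since the generators are real, every nonzero element of the cone is real.\<close>

definition proj_cone :: "(nat \<Rightarrow> real^'n) \<Rightarrow> nat \<Rightarrow> 'n tproj set" where
  "proj_cone v p = to_proj ` {x. real_to_rmax x \<in> mp_cone v p}"

text \<open>Only meaningful for non-empty proper \<open>K\<close>; depends on \<open>b\<close> only modulo constants.\<close>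

definition halfspace :: "real^'n \<Rightarrow> 'n set \<Rightarrow> (ereal^'n) set" where
  "halfspace b K = {x \<in> rmax_vecs - {rmax_zero}.
     (MAX i\<in>K. x $ i - ereal (b $ i)) \<ge> (MAX j\<in>-K. x $ j - ereal (b $ j))}"

definition halfspaces_at :: "(nat \<Rightarrow> real^'n) \<Rightarrow> nat \<Rightarrow> 'n tproj \<Rightarrow> (ereal^'n) set set" where
  "halfspaces_at v p a = {halfspace b K |b K.
     to_proj b = a \<and> K \<noteq> {} \<and> K \<noteq> UNIV \<and> mp_cone v p - {rmax_zero} \<subseteq> halfspace b K}"

definition halfspaces :: "(nat \<Rightarrow> real^'n) \<Rightarrow> nat \<Rightarrow> (ereal^'n) set set" where
  "halfspaces v p = {halfspace b K |b K.
     K \<noteq> {} \<and> K \<noteq> UNIV \<and> mp_cone v p - {rmax_zero} \<subseteq> halfspace b K \<and> to_proj b \<in> proj_cone v p}"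

definition tau :: "(nat \<Rightarrow> real^'n) \<Rightarrow> nat \<Rightarrow> (ereal^'n) set set \<Rightarrow> (ereal^'n) set set" where
  "tau v p G = (if G = {} then {} else {H \<in> halfspaces v p. \<Inter>G \<subseteq> H})"

definition tau' :: "(nat \<Rightarrow> real^'n) \<Rightarrow> nat \<Rightarrow> 'n tproj set \<Rightarrow> 'n tproj set" where
  "tau' v p X = {b \<in> frontier (proj_cone v p).
     halfspaces_at v p b \<subseteq> tau v p (\<Union>c\<in>X. halfspaces_at v p c)}"

text \<open>
  The set of non-redundant apices is characterised by this predicate rather than by a
  definite description, so that its uniqueness need not be established beforehand.
\<close>

definition is_nonredundant_apices :: "(nat \<Rightarrow> real^'n) \<Rightarrow> nat \<Rightarrow> 'n tproj set \<Rightarrow> bool" where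
  "is_nonredundant_apices v p X \<longleftrightarrow>
     finite X \<and> X \<subseteq> frontier (proj_cone v p) \<and> tau' v p X = frontier (proj_cone v p) \<and>
     (\<forall>Y. Y \<subset> X \<longrightarrow> tau' v p Y \<noteq> frontier (proj_cone v p))"

definition sector :: "(nat \<Rightarrow> real^'n) \<Rightarrow> nat \<Rightarrow> 'n \<Rightarrow> real^'n \<Rightarrow> nat set" where
  "sector v p j x = {r \<in> {1..p}. \<forall>i. v r $ j - x $ j \<ge> v r $ i - x $ i}"

lemma sector_cong: "tproj_rel x y \<Longrightarrow> sector v p j x = sector v p j y"
  by (force simp: sector_def tproj_rel_def)

lift_definition is_vertex ::
    "(nat \<Rightarrow> real^'n) \<Rightarrow> nat \<Rightarrow> 'n set \<Rightarrow> 'n \<Rightarrow> 'n tproj \<Rightarrow> bool" is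
  "\<lambda>v p I j a.
     (\<Union>i\<in>I. sector v p i a) = {1..p} \<and>
     (\<forall>k. k \<notin> I \<longrightarrow> (\<exists>i\<in>I. sector v p i a \<inter> sector v p k a \<noteq> {})) \<and>
     (\<forall>i\<in>I. \<not> sector v p i a \<inter> sector v p j a \<subseteq> (\<Union>k\<in>I - {i}. sector v p k a))"
  by (simp add: sector_cong)

end

theory Submission
  imports Defs
begin

text \<open>
  Write \<open>T c x\<close> for the set of indices maximising \<open>x - c\<close>.  A point \<open>x\<close> lies in all half-spaces
  with apex \<open>c\<close> containing the cone iff \<open>T c (v r) \<subseteq> T c x\<close> for some generator \<open>v r\<close>; call such an
  \<open>x\<close> covered at \<open>c\<close>.  These half-spaces satisfy an anti-exchange property: if two apices \<open>a\<close> and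
  \<open>b\<close> could replace each other, then following the tropical segments from a cut-off point \<open>y\<close>
  to \<open>a\<close> and to \<open>b\<close> shows that \<open>b - a\<close> attains its maximum and its minimum at a common index.
  Hence for a non-redundant apex \<open>a\<close> and any finite set \<open>B\<close> of other points of the cone, some point
  \<open>y\<close> is covered at every \<open>b \<in> B\<close> but not at \<open>a\<close>.  This is applied with \<open>B\<close> consisting of the points
  \<open>a - e 1\<^sub>L\<close> of the cone for a small \<open>e > 0\<close>.  With \<open>D\<close> maximal among the supersets of \<open>T a y\<close>
  containing no \<open>T a (v r)\<close>, the point \<open>a\<close> is an \<open>(I, j)\<close>-vertex for \<open>I = - D\<close> and any \<open>j \<in> T a y\<close>.
\<close>

section \<open>Maximising coordinates and the covering relation\<close>

definition tight :: "real^'n \<Rightarrow> real^'n \<Rightarrow> 'n set" where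
  "tight c x = {j. \<forall>i. x $ i - c $ i \<le> x $ j - c $ j}"

definition covered :: "(nat \<Rightarrow> real^'n) \<Rightarrow> nat \<Rightarrow> real^'n \<Rightarrow> real^'n \<Rightarrow> bool" where
  "covered v p c x \<longleftrightarrow> (\<exists>r\<in>{1..p}. tight c (v r) \<subseteq> tight c x)"

text \<open>The real part of the tropical span in sector form: every coordinate of \<open>x\<close>
  is reached by some generator shifted as high as fits below \<open>x\<close>.\<close>

definition real_cone :: "(nat \<Rightarrow> real^'n) \<Rightarrow> nat \<Rightarrow> (real^'n) set" where
  "real_cone v p = {x. \<forall>j. \<exists>r\<in>{1..p}. j \<in> tight x (v r)}"

lemma real_coneE:
  assumes "x \<in> real_cone v p"
  obtains r where "r \<in> {1..p}" "j \<in> tight x (v r)"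
  using assms unfolding real_cone_def by blast

lemma sector_eq_tight: "sector v p j x = {r\<in>{1..p}. j \<in> tight x (v r)}"
  by (auto simp: sector_def tight_def)

lemma tight_nonempty: "tight c x \<noteq> {}"
proof -
  let ?f = "\<lambda>i. x $ i - c $ i"
  have "Max (range ?f) \<in> range ?f"
    by (intro Max_in) auto
  then obtain j where "?f j = Max (range ?f)"
    by (metis (no_types, lifting) imageE)
  then have "j \<in> tight c x"
    by (simp add: tight_def)
  then show ?thesis by blast
qed

lemma tight_cong: "to_proj b = to_proj c \<Longrightarrow> tight b x = tight c x"
  by (auto simp: tight_def to_proj_eq_iff)

lemma covered_cong: "to_proj b = to_proj c \<Longrightarrow> covered v p b x = covered v p c x"
  using tight_cong[of b c] by (simp add: covered_def)

lemma tight_gap: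
  obtains e where "e > 0"
    "\<And>i j. i \<in> tight c x \<Longrightarrow> j \<notin> tight c x \<Longrightarrow> x $ j - c $ j + e \<le> x $ i - c $ i"
proof -
  obtain m where m: "m \<in> tight c x"
    using tight_nonempty by blast
  let ?g = "\<lambda>j. (x $ m - c $ m) - (x $ j - c $ j)"
  \<comment> \<open>Inserting \<open>1\<close> keeps the minimum defined when every coordinate is
    tight.\<close>
  define e where "e = Min (insert 1 (?g ` (- tight c x)))"
  have pos: "?g j > 0" if j: "j \<notin> tight c x" for j
  proof -
    obtain i where "x $ j - c $ j < x $ i - c $ i"
      using j unfolding tight_def mem_Collect_eq not_all not_le by blast
    moreover have "x $ i - c $ i \<le> x $ m - c $ m"
      using m by (simp add: tight_def)
    ultimately show ?thesis by simp
  qed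
  have "e > 0"
    unfolding e_def using pos by (subst Min_gr_iff) auto
  moreover have "x $ j - c $ j + e \<le> x $ i - c $ i" if "i \<in> tight c x" "j \<notin> tight c x" for i j
  proof -
    have "e \<le> ?g j"
      unfolding e_def using that by (intro Min_le) auto
    moreover have "x $ i - c $ i \<ge> x $ m - c $ m"
      using that by (simp add: tight_def)
    ultimately show ?thesis by simp
  qed
  ultimately show thesis using that by blast
qed

section \<open>Half-spaces and the cone\<close>

lemma halfspace_iff:
  assumes "K \<noteq> {}" "K \<noteq> UNIV"
  shows "x \<in> halfspace b K \<longleftrightarrow> x \<in> rmax_vecs - {rmax_zero} \<and>
    (\<forall>j\<in>-K. \<exists>i\<in>K. x $ j - ereal (b $ j) \<le> x $ i - ereal (b $ i))"
proof -
  have "-K \<noteq> {}" using assms by auto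
  then have "(MAX i\<in>K. x $ i - ereal (b $ i)) \<ge> (MAX j\<in>-K. x $ j - ereal (b $ j)) \<longleftrightarrow>
      (\<forall>j\<in>-K. x $ j - ereal (b $ j) \<le> (MAX i\<in>K. x $ i - ereal (b $ i)))"
    by (subst Max_le_iff) auto
  also have "\<dots> \<longleftrightarrow> (\<forall>j\<in>-K. \<exists>i\<in>K. x $ j - ereal (b $ j) \<le> x $ i - ereal (b $ i))"
    using assms by (simp add: Max_ge_iff)
  finally show ?thesis
    by (simp add: halfspace_def)
qed

lemma real_to_rmax_nonzero: "real_to_rmax x \<in> rmax_vecs - {rmax_zero}"
  by (auto simp: real_to_rmax_def rmax_vecs_def rmax_zero_def vec_eq_iff)

text \<open>The maximum over \<open>K\<close> dominates the rest exactly when the overall maximum of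
  \<open>x - b\<close> is attained inside \<open>K\<close>.\<close>

lemma real_mem_halfspace_iff:
  assumes "K \<noteq> {}" "K \<noteq> UNIV"
  shows "real_to_rmax x \<in> halfspace b K \<longleftrightarrow> tight b x \<inter> K \<noteq> {}"
proof -
  have "(\<forall>j\<in>-K. \<exists>i\<in>K. x $ j - b $ j \<le> x $ i - b $ i) \<longleftrightarrow> tight b x \<inter> K \<noteq> {}"
  proof
    assume L: "\<forall>j\<in>-K. \<exists>i\<in>K. x $ j - b $ j \<le> x $ i - b $ i"
    obtain m where m: "m \<in> tight b x"
      using tight_nonempty by blast
    show "tight b x \<inter> K \<noteq> {}"
    proof (cases "m \<in> K")
      case False
      then obtain i where "i \<in> K" "x $ m - b $ m \<le> x $ i - b $ i"
        using L by blast
      then have "i \<in> tight b x"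
        using m unfolding tight_def by (auto intro: order_trans)
      with \<open>i \<in> K\<close> show ?thesis by blast
    qed (use m in blast)
  qed (auto simp: tight_def)
  then show ?thesis
    using halfspace_iff[OF assms] real_to_rmax_nonzero[of x] by (simp add: real_to_rmax_def)
qed

lemma finite_SUP_attained:
  fixes f :: "'a \<Rightarrow> ereal"
  assumes "finite A" "A \<noteq> {}"
  obtains r where "r \<in> A" "(SUP r\<in>A. f r) = f r"
proof -
  have "Max (f ` A) \<in> f ` A" using assms by (intro Max_in) auto
  moreover have "(SUP r\<in>A. f r) = Max (f ` A)" using assms by (simp add: Max_Sup)
  ultimately show thesis using that by auto
qed

lemma real_to_rmax_mem_mp_cone_iff:
  "real_to_rmax x \<in> mp_cone v p \<longleftrightarrow> x \<in> real_cone v p"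
proof
  assume "real_to_rmax x \<in> mp_cone v p"
  then obtain l where l: "\<forall>r\<in>{1..p}. l r \<noteq> \<infinity>"
    and x: "\<And>i. ereal (x $ i) = (SUP r\<in>{1..p}. l r + ereal (v r $ i))"
    by (auto simp: mp_cone_def real_to_rmax_def vec_eq_iff)
  \<comment> \<open>With no generators the suprema would be \<open>-\<infinity>\<close>, whereas
    \<open>x\<close> is real.\<close>
  have "p \<ge> 1"
    using x by (cases p) (auto simp: bot_ereal_def)
  have "\<exists>r\<in>{1..p}. j \<in> tight x (v r)" for j
  proof -
    obtain r where r: "r \<in> {1..p}" and xj: "ereal (x $ j) = l r + ereal (v r $ j)"
      using finite_SUP_attained[of "{1..p}" "\<lambda>r. l r + ereal (v r $ j)"] x \<open>p \<ge> 1\<close>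
      by (metis atLeastatMost_empty_iff finite_atLeastAtMost not_less)
    obtain m where m: "l r = ereal m"
      using xj by (cases "l r") auto
    have "l r + ereal (v r $ i) \<le> ereal (x $ i)" for i
      unfolding x using r by (intro SUP_upper)
    then have "m + v r $ i \<le> x $ i" for i
      by (simp add: m)
    moreover have "x $ j = m + v r $ j"
      using xj by (simp add: m)
    ultimately have "v r $ i - x $ i \<le> v r $ j - x $ j" for i
      by (smt (verit))
    then have "j \<in> tight x (v r)"
      by (simp add: tight_def)
    with r show ?thesis by blast
  qed
  then show "x \<in> real_cone v p"
    by (simp add: real_cone_def)
next
  assume x: "x \<in> real_cone v p"
  \<comment> \<open>The residual: \<open>m r\<close> is the largest shift keeping generator
    \<open>r\<close> below \<open>x\<close>. The shifted generator touches \<open>x\<close> exactly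
    at the coordinates in \<open>tight x (v r)\<close>.\<close>
  define m where "m r = Min (range (\<lambda>i. x $ i - v r $ i))" for r
  have le: "m r + v r $ i \<le> x $ i" for r i
  proof -
    have "m r \<le> x $ i - v r $ i"
      unfolding m_def by (intro Min_le) auto
    then show ?thesis by simp
  qed
  have "ereal (x $ j) = (SUP r\<in>{1..p}. ereal (m r) + ereal (v r $ j))" for j
  proof (rule antisym)
    obtain r where r: "r \<in> {1..p}" and j: "j \<in> tight x (v r)"
      using x by (rule real_coneE)
    have "m r \<in> range (\<lambda>i. x $ i - v r $ i)"
      unfolding m_def by (intro Min_in) auto
    then obtain i where "m r = x $ i - v r $ i" by auto
    then have "x $ j \<le> m r + v r $ j"
      using j by (auto simp: tight_def dest: spec[of _ i])
    then show "ereal (x $ j) \<le> (SUP r\<in>{1..p}. ereal (m r) + ereal (v r $ j))"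
      using r by (intro SUP_upper2) auto
  qed (use le in \<open>auto intro!: SUP_least\<close>)
  then have "real_to_rmax x = (\<chi> i. SUP r\<in>{1..p}. ereal (m r) + ereal (v r $ i))"
    by (simp add: real_to_rmax_def vec_eq_iff)
  then show "real_to_rmax x \<in> mp_cone v p"
    unfolding mp_cone_def by (auto intro!: exI[of _ "\<lambda>r. ereal (m r)"])
qed

lemma real_cone_cong:
  assumes "to_proj x = to_proj y"
  shows "x \<in> real_cone v p \<longleftrightarrow> y \<in> real_cone v p"
  using tight_cong[OF assms] by (simp add: real_cone_def)

lemma to_proj_mem_proj_cone_iff: "to_proj x \<in> proj_cone v p \<longleftrightarrow> x \<in> real_cone v p"
  by (auto simp: proj_cone_def real_to_rmax_mem_mp_cone_iff dest: real_cone_cong)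

lemma closed_real_cone: "closed (real_cone v p)"
proof -
  have "real_cone v p =
    (\<Inter>j. \<Union>r\<in>{1..p}. \<Inter>i. {x. v r $ i - x $ i \<le> v r $ j - x $ j})"
    by (auto simp: real_cone_def tight_def)
  then show ?thesis
    by (auto intro!: closed_INT closed_UN closed_Collect_le continuous_intros)
qed

text \<open>In the quotient topology closedness is tested on the preimage, which is
  \<open>real_cone v p\<close>.\<close>

lemma closed_proj_cone: "closed (proj_cone v p)"
proof -
  have "to_proj -` (- proj_cone v p) = - real_cone v p"
    using to_proj_mem_proj_cone_iff by auto
  then show ?thesis
    using closed_real_cone by (simp add: closed_def open_tproj_def)
qed

lemma generator_mem_real_cone:
  assumes "r \<in> {1..p}"
  shows "v r \<in> real_cone v p"
  unfolding real_cone_def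
proof (intro CollectI allI)
  show "\<exists>s\<in>{1..p}. j \<in> tight (v r) (v s)" for j
    using assms by (intro bexI[of _ r]) (simp_all add: tight_def)
qed

text \<open>Half-space inequalities survive tropical combinations: the generator attaining
  coordinate \<open>j\<close> of \<open>x\<close> has an index in \<open>K\<close> that dominates
  \<open>j\<close>. So checking the generators suffices.\<close>

lemma mp_cone_subset_halfspace:
  assumes "K \<noteq> {}" "K \<noteq> UNIV" "p \<ge> 1" and K: "\<And>r. r \<in> {1..p} \<Longrightarrow> tight b (v r) \<inter> K \<noteq> {}"
  shows "mp_cone v p - {rmax_zero} \<subseteq> halfspace b K"
proof
  fix x assume x: "x \<in> mp_cone v p - {rmax_zero}"
  then obtain l where l: "\<forall>r\<in>{1..p}. l r \<noteq> \<infinity>"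
    and xi: "\<And>i. x $ i = (SUP r\<in>{1..p}. l r + ereal (v r $ i))"
    by (auto simp: mp_cone_def)
  have att: "\<exists>r\<in>{1..p}. x $ j = l r + ereal (v r $ j)" for j
    using finite_SUP_attained[of "{1..p}" "\<lambda>r. l r + ereal (v r $ j)"] xi \<open>p \<ge> 1\<close>
    by (metis atLeastatMost_empty_iff finite_atLeastAtMost not_less)
  have "x \<in> rmax_vecs"
    unfolding rmax_vecs_def
  proof (intro CollectI allI)
    show "x $ j \<noteq> \<infinity>" for j
      using att[of j] l by auto
  qed
  moreover have "\<exists>i\<in>K. x $ j - ereal (b $ j) \<le> x $ i - ereal (b $ i)" for j
  proof -
    obtain r where r: "r \<in> {1..p}" and xj: "x $ j = l r + ereal (v r $ j)"
      using att by blast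
    obtain i where i: "i \<in> tight b (v r)" "i \<in> K"
      using K[OF r] by blast
    have vr: "v r $ j - b $ j \<le> v r $ i - b $ i"
      using i by (simp add: tight_def)
    have "l r + ereal (v r $ i) \<le> x $ i"
      unfolding xi using r by (intro SUP_upper)
    then have "(l r + ereal (v r $ i)) - ereal (b $ i) \<le> x $ i - ereal (b $ i)"
      by (intro ereal_minus_mono) auto
    moreover have "(l r + ereal (v r $ j)) - ereal (b $ j) \<le> (l r + ereal (v r $ i)) - ereal (b $ i)"
      using vr by (cases "l r") auto
    ultimately show ?thesis
      unfolding xj using i(2) order_trans by blast
  qed
  ultimately show "x \<in> halfspace b K"
    using x assms by (simp add: halfspace_iff)
qed

text \<open>
  A point \<open>x\<close> violates some half-space with apex \<open>b\<close> exactly when it violates the one whose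
  index set is the complement of \<open>tight b x\<close>.
\<close>

lemma covered_iff_halfspaces:
  assumes "p \<ge> 1"
  shows "covered v p b x \<longleftrightarrow>
    (\<forall>K. K \<noteq> {} \<longrightarrow> K \<noteq> UNIV \<longrightarrow> mp_cone v p - {rmax_zero} \<subseteq> halfspace b K \<longrightarrow>
      real_to_rmax x \<in> halfspace b K)" (is "?L \<longleftrightarrow> ?R")
proof
  assume ?L
  then obtain r where r: "r \<in> {1..p}" and sub: "tight b (v r) \<subseteq> tight b x"
    by (auto simp: covered_def)
  show ?R
  proof (intro allI impI)
    fix K :: "'a set"
    assume K: "K \<noteq> {}" "K \<noteq> UNIV" and C: "mp_cone v p - {rmax_zero} \<subseteq> halfspace b K"
    have "real_to_rmax (v r) \<in> halfspace b K"
      using C generator_mem_real_cone[OF r, of v] real_to_rmax_nonzero[of "v r"]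
      by (auto simp: real_to_rmax_mem_mp_cone_iff)
    then show "real_to_rmax x \<in> halfspace b K"
      using sub K by (auto simp: real_mem_halfspace_iff)
  qed
next
  assume R: ?R
  show ?L
  proof (rule ccontr)
    assume n: "\<not> ?L"
    define K where "K = - tight b x"
    have "K \<noteq> UNIV"
      using tight_nonempty by (auto simp: K_def)
    \<comment> \<open>If \<open>K\<close> were empty, \<open>tight b x\<close> would contain every
      index and any generator would cover \<open>x\<close>.\<close>
    moreover have "K \<noteq> {}"
      using n \<open>p \<ge> 1\<close> by (auto simp: K_def covered_def Bex_def)
    moreover have "tight b (v r) \<inter> K \<noteq> {}" if "r \<in> {1..p}" for r
      using n that by (auto simp: K_def covered_def)
    ultimately show False
      using R mp_cone_subset_halfspace[of K p b v] real_mem_halfspace_iff[of K x b] \<open>p \<ge> 1\<close>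
      by (auto simp: K_def)
  qed
qed

section \<open>Points of the cone, joins, and interior apices\<close>

lemma covered_of_mem_real_cone:
  assumes "b \<in> real_cone v p"
  shows "covered v p c b"
proof -
  obtain j where j: "j \<in> tight c b"
    using tight_nonempty by blast
  obtain r where r: "r \<in> {1..p}" "j \<in> tight b (v r)"
    using assms by (rule real_coneE)
  \<comment> \<open>Shifted to touch \<open>b\<close> at \<open>j\<close>, generator
    \<open>r\<close> lies below \<open>b\<close>. As \<open>b - c\<close> is maximal at
    \<open>j\<close>, every maximiser for the generator is one for \<open>b\<close>.\<close>
  have "i \<in> tight c b" if "i \<in> tight c (v r)" for i
  proof -
    have "v r $ j - c $ j \<le> v r $ i - c $ i" "v r $ i - b $ i \<le> v r $ j - b $ j"
      using that r by (auto simp: tight_def)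
    then have "b $ j - c $ j \<le> b $ i - c $ i" by simp
    with j show ?thesis
      unfolding tight_def by (auto intro: order_trans)
  qed
  with r show ?thesis unfolding covered_def by blast
qed

lemma tight_subset_sup:
  assumes "j \<in> tight c x" "k \<in> tight c y" "y $ k - c $ k \<le> x $ j - c $ j"
    and "\<And>i. z $ i = max (x $ i) (y $ i)"
  shows "tight c x \<subseteq> tight c z"
proof
  fix m assume m: "m \<in> tight c x"
  have "z $ i - c $ i \<le> z $ m - c $ m" for i
  proof -
    have "x $ i - c $ i \<le> x $ m - c $ m" "x $ j - c $ j \<le> x $ m - c $ m"
      "y $ i - c $ i \<le> y $ k - c $ k"
      using m assms(1,2) by (simp_all add: tight_def)
    then show ?thesis
      unfolding assms(4) using assms(3) by linarith
  qed
  then show "m \<in> tight c z"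
    by (simp add: tight_def)
qed

text \<open>Of \<open>x - c\<close> and \<open>y - c\<close>, the one with the larger maximum passes
  its maximisers, and hence its covering generator, on to the join.\<close>

lemma covered_sup:
  assumes "covered v p c x" "covered v p c y" "\<And>i. z $ i = max (x $ i) (y $ i)"
  shows "covered v p c z"
proof -
  obtain j k where "j \<in> tight c x" "k \<in> tight c y"
    using tight_nonempty by blast
  then have "tight c x \<subseteq> tight c z \<or> tight c y \<subseteq> tight c z"
    using tight_subset_sup[of j c x k y z] tight_subset_sup[of k c y j x z] assms(3)
    by (metis linear max.commute)
  with assms(1,2) show ?thesis
    unfolding covered_def by blast
qed

lemma covered_translate: "covered v p c (\<chi> i. s + x $ i) \<longleftrightarrow> covered v p c x"
proof -
  have "tight c (\<chi> i. s + x $ i) = tight c x"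
    by (auto simp: tight_def algebra_simps)
  then show ?thesis by (simp add: covered_def)
qed

text \<open>Raise \<open>b\<close> by a small \<open>d\<close> on \<open>tight b x\<close>, staying
  in the cone. A generator reaching a raised coordinate \<open>j\<close> is, relative to
  \<open>b\<close>, larger at \<open>j\<close> by at least \<open>d\<close> than at any index off
  \<open>tight b x\<close>, so its maximisers lie in \<open>tight b x\<close>.\<close>

lemma covered_interior:
  assumes "to_proj b \<in> proj_cone v p" "to_proj b \<notin> frontier (proj_cone v p)"
  shows "covered v p b x"
proof -
  have "to_proj b \<in> interior (proj_cone v p)"
    using assms closure_subset by (auto simp: frontier_def)
  then obtain U where U: "open U" "to_proj b \<in> U" "U \<subseteq> proj_cone v p"
    by (auto simp: interior_def)
  then obtain e where e: "e > 0" "ball b e \<subseteq> to_proj -` U"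
    unfolding open_tproj_def open_contains_ball by (metis vimageI)
  define w :: "real^'a" where "w = (\<chi> i. if i \<in> tight b x then 1 else 0)"
  define d where "d = e / (2 * (norm w + 1))"
  have d: "d > 0"
    using e by (simp add: d_def add_nonneg_pos)
  have "norm (d *\<^sub>R w) < e"
  proof -
    have "d * norm w \<le> d * (norm w + 1)" using d by simp
    also have "\<dots> = e / 2"
      by (simp add: d_def field_simps add_nonneg_eq_0_iff)
    finally show ?thesis using e d by simp
  qed
  then have "b + d *\<^sub>R w \<in> ball b e"
    by (simp add: dist_norm)
  then have "b + d *\<^sub>R w \<in> real_cone v p"
    using e U by (auto simp flip: to_proj_mem_proj_cone_iff)
  moreover obtain j where j: "j \<in> tight b x"
    using tight_nonempty by blast
  ultimately obtain r where r: "r \<in> {1..p}" "j \<in> tight (b + d *\<^sub>R w) (v r)"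
    using real_coneE by blast
  have "i \<in> tight b x" if i: "i \<in> tight b (v r)" for i
  proof (rule ccontr)
    assume "i \<notin> tight b x"
    moreover have "v r $ i - (b + d *\<^sub>R w) $ i \<le> v r $ j - (b + d *\<^sub>R w) $ j"
      using r(2) by (simp add: tight_def)
    ultimately have "v r $ i - b $ i \<le> v r $ j - b $ j - d"
      using j by (simp add: w_def)
    moreover have "v r $ j - b $ j \<le> v r $ i - b $ i"
      using i by (simp add: tight_def)
    ultimately show False using d by simp
  qed
  with r show ?thesis unfolding covered_def by blast
qed

section \<open>Anti-exchange\<close>

text \<open>
  The premise is used at a single \<open>s\<close>, just below the value at which the segment from \<open>y\<close>
  reaches \<open>b\<close>: there \<open>tight b\<close> is still that of \<open>y\<close>, while disjointness would make \<open>tight a\<close>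
  contain that of \<open>b\<close>.
\<close>

lemma tight_meet_of_not_covered:
  assumes b: "b \<in> real_cone v p" and nb: "\<not> covered v p b y"
    and imp: "\<And>s. covered v p a (\<chi> i. max (y $ i) (s + b $ i)) \<Longrightarrow>
      covered v p b (\<chi> i. max (y $ i) (s + b $ i))"
  shows "tight a b \<inter> tight b y \<noteq> {}"
proof
  assume empty: "tight a b \<inter> tight b y = {}"
  obtain e where e: "e > 0"
    "\<And>i j. i \<in> tight b y \<Longrightarrow> j \<notin> tight b y \<Longrightarrow> y $ j - b $ j + e \<le> y $ i - b $ i"
    using tight_gap[of b y] by metis
  obtain d where d: "d > 0"
    "\<And>i j. i \<in> tight a b \<Longrightarrow> j \<notin> tight a b \<Longrightarrow> b $ j - a $ j + d \<le> b $ i - a $ i"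
    using tight_gap[of a b] by metis
  obtain m where m: "m \<in> tight b y"
    using tight_nonempty by blast
  \<comment> \<open>At \<open>y $ m - b $ m\<close> the translate of \<open>b\<close> would dominate
    \<open>y\<close>. Backing off by at most \<open>e\<close> leaves \<open>y\<close> above it only
    on \<open>tight b y\<close>; backing off by at most \<open>d\<close> is absorbed there by the
    slack of \<open>b - a\<close> off \<open>tight a b\<close>.\<close>
  define s where "s = y $ m - b $ m - min e d"
  define z where "z = (\<chi> i. max (y $ i) (s + b $ i))"
  have le: "y $ k - b $ k \<le> y $ m - b $ m" for k
    using m by (simp add: tight_def)
  have "tight a b \<subseteq> tight a z"
  proof
    fix k assume k: "k \<in> tight a b"
    have kz: "s + (b $ k - a $ k) \<le> z $ k - a $ k"
      by (simp add: z_def)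
    have "z $ i - a $ i \<le> s + (b $ k - a $ k)" for i
    proof -
      have ik: "b $ i - a $ i \<le> b $ k - a $ k"
        using k by (simp add: tight_def)
      have "y $ i - a $ i \<le> s + (b $ k - a $ k)"
      proof (cases "i \<in> tight b y")
        case True
        then have "b $ i - a $ i + d \<le> b $ k - a $ k"
          using d k empty by blast
        then show ?thesis
          using le[of i] by (simp add: s_def)
      next
        case False
        then have "y $ i - b $ i + e \<le> y $ m - b $ m"
          using e m by blast
        then show ?thesis
          using ik by (simp add: s_def)
      qed
      with ik show ?thesis by (simp add: z_def)
    qed
    with kz show "k \<in> tight a z"
      unfolding tight_def by (blast intro: order_trans)
  qed
  moreover have "covered v p a b"
    using b by (rule covered_of_mem_real_cone)
  ultimately have "covered v p a z"
    unfolding covered_def by blast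
  then have "covered v p b z"
    using imp unfolding z_def by blast
  \<comment> \<open>Relative to \<open>b\<close> the translate is constantly \<open>s\<close>,
    strictly below the maximum of \<open>y - b\<close>, so only coordinates taken from
    \<open>y\<close> can be maximal.\<close>
  moreover have "tight b z \<subseteq> tight b y"
  proof
    fix k assume "k \<in> tight b z"
    then have "y $ m - b $ m \<le> z $ k - b $ k"
      by (auto simp: tight_def z_def dest!: spec[of _ m])
    then have "y $ m - b $ m \<le> y $ k - b $ k"
      using e(1) d(1) by (auto simp: z_def s_def max_def split: if_splits)
    with le show "k \<in> tight b y"
      unfolding tight_def by (auto intro: order_trans)
  qed
  ultimately show False
    using nb unfolding covered_def by blast
qed

text \<open>\<open>a - b\<close> is minimal at \<open>j\<close> and maximal at \<open>k\<close>. The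
  two inequalities for \<open>y\<close> make its value at \<open>k\<close> at most that at
  \<open>j\<close>, so it is constant.\<close>

lemma to_proj_eq_of_tight_meet:
  assumes "tight a b \<inter> tight b y \<noteq> {}" "tight b a \<inter> tight a y \<noteq> {}"
  shows "to_proj a = to_proj b"
proof -
  obtain j k where j: "j \<in> tight a b" "j \<in> tight b y" and k: "k \<in> tight b a" "k \<in> tight a y"
    using assms by blast
  have "a $ i = (a $ j - b $ j) + b $ i" for i
  proof -
    have "b $ i - a $ i \<le> b $ j - a $ j" "y $ k - b $ k \<le> y $ j - b $ j"
      "a $ i - b $ i \<le> a $ k - b $ k" "y $ j - a $ j \<le> y $ k - a $ k"
      using j k by (simp_all add: tight_def)
    then show ?thesis by simp
  qed
  then show ?thesis
    unfolding to_proj_eq_iff by blast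
qed

text \<open>If the conclusion fails, \<open>a\<close> and \<open>b\<close> can replace each other
  over \<open>X\<close>. Joins of \<open>y\<close> with translates of either stay covered on
  \<open>X\<close>, so \<open>tight_meet_of_not_covered\<close> applies in both directions.\<close>

lemma anti_exchange:
  assumes ab: "a \<in> real_cone v p" "b \<in> real_cone v p" "to_proj a \<noteq> to_proj b"
    and y: "\<not> covered v p a y" "\<And>c. c \<in> X \<Longrightarrow> covered v p c y"
    and X: "\<And>x. \<lbrakk>\<And>c. c \<in> X \<Longrightarrow> covered v p c x; covered v p a x\<rbrakk> \<Longrightarrow> covered v p b x"
  shows "\<exists>z. \<not> covered v p a z \<and> (\<forall>c\<in>insert b X. covered v p c z)"
proof (rule ccontr)
  assume "\<not> ?thesis"
  then have X': "covered v p a x" if "\<And>c. c \<in> X \<Longrightarrow> covered v p c x" "covered v p b x" for x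
    using that by blast
  have seg: "covered v p c (\<chi> i. max (y $ i) (s + d $ i))"
    if "c \<in> X" "d \<in> real_cone v p" for c d s
  proof (rule covered_sup)
    show "covered v p c y"
      using y(2) that(1) .
    show "covered v p c (\<chi> i. s + d $ i)"
      using covered_of_mem_real_cone[OF that(2)] by (simp only: covered_translate)
  qed simp
  have "\<not> covered v p b y"
    using X' y by blast
  then have "tight a b \<inter> tight b y \<noteq> {}"
    by (rule tight_meet_of_not_covered[OF ab(2)]) (use X seg[OF _ ab(2)] in blast)
  moreover have "tight b a \<inter> tight a y \<noteq> {}"
    by (rule tight_meet_of_not_covered[OF ab(1) y(1)]) (use X' seg[OF _ ab(1)] in blast)
  ultimately show False
    using ab(3) to_proj_eq_of_tight_meet by blast
qed

text \<open>The points of \<open>B\<close> are added one at a time by anti-exchange. Keeping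
  \<open>X\<close> in the induction statement lets \<open>X\<close> and \<open>a\<close> still imply
  covering at the next point.\<close>

lemma not_covered_avoiding_finite:
  assumes a: "a \<in> real_cone v p"
    and B: "finite B" "\<forall>b\<in>B. b \<in> real_cone v p \<and> to_proj b \<noteq> to_proj a"
    and y: "\<not> covered v p a y" "\<forall>c\<in>X. covered v p c y"
    and X: "\<And>b x. \<lbrakk>b \<in> real_cone v p; \<forall>c\<in>X. covered v p c x; covered v p a x\<rbrakk>
      \<Longrightarrow> covered v p b x"
  shows "\<exists>z. \<not> covered v p a z \<and> (\<forall>b\<in>B. covered v p b z)"
proof -
  have "\<exists>z. \<not> covered v p a z \<and> (\<forall>c\<in>B \<union> X. covered v p c z)"
    using B
  proof (induction B)
    case empty
    with y show ?case by auto
  next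
    case (insert b B)
    then obtain w where w: "\<not> covered v p a w" "\<And>c. c \<in> B \<union> X \<Longrightarrow> covered v p c w"
      by auto
    have b: "b \<in> real_cone v p" "to_proj a \<noteq> to_proj b"
      using insert.prems by auto
    have cov: "covered v p b x"
      if "\<And>c. c \<in> B \<union> X \<Longrightarrow> covered v p c x" "covered v p a x" for x
      using X[OF b(1)] that by blast
    have "\<exists>z. \<not> covered v p a z \<and> (\<forall>c\<in>insert b (B \<union> X). covered v p c z)"
      using anti_exchange[OF a b w cov] by blast
    then show ?case by simp
  qed
  then show ?thesis by blast
qed

section \<open>Non-redundant apices are vertices\<close>

lemma frontier_subset_proj_cone: "frontier (proj_cone v p) \<subseteq> proj_cone v p"
  using closed_proj_cone by (rule frontier_subset_closed)

text \<open>Turns generation of the frontier into control of the whole cone: frontier apices follow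
  from \<open>tau'\<close>, while interior apices cover every point.\<close>

lemma covered_of_tau':
  assumes p: "p \<ge> 1" and A: "tau' v p A = frontier (proj_cone v p)"
    and b: "b \<in> real_cone v p" and x: "\<And>c. to_proj c \<in> A \<Longrightarrow> covered v p c x"
  shows "covered v p b x"
proof (cases "to_proj b \<in> frontier (proj_cone v p)")
  case True
  then have sub: "halfspaces_at v p (to_proj b) \<subseteq> tau v p (\<Union>c\<in>A. halfspaces_at v p c)"
    using A by (auto simp: tau'_def)
  have all: "real_to_rmax x \<in> H" if "c \<in> A" "H \<in> halfspaces_at v p c" for c H
    using that x covered_iff_halfspaces[OF p, of v _ x] by (auto simp: halfspaces_at_def)
  have "real_to_rmax x \<in> H" if "H \<in> halfspaces_at v p (to_proj b)" for H
  proof -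
    have "\<Inter>(\<Union>c\<in>A. halfspaces_at v p c) \<subseteq> H"
      using sub that by (auto simp: tau_def split: if_splits)
    moreover have "real_to_rmax x \<in> \<Inter>(\<Union>c\<in>A. halfspaces_at v p c)"
      using all by blast
    ultimately show ?thesis by blast
  qed
  then show ?thesis
    unfolding covered_iff_halfspaces[OF p] halfspaces_at_def by blast
next
  case False
  with b show ?thesis
    by (intro covered_interior) (simp_all add: to_proj_mem_proj_cone_iff)
qed

text \<open>
  Replacing a separating point \<open>y\<close>, which may have entries \<open>-\<infinity>\<close>, by \<open>max y (s + a)\<close> makes all
  entries real.
\<close>

lemma halfspace_sup_real:
  assumes K: "K \<noteq> {}" "K \<noteq> UNIV" and y: "y \<in> halfspace c K" and a: "real_to_rmax a \<in> halfspace c K"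
    and z: "\<And>i. ereal (z $ i) = max (y $ i) (ereal (s + a $ i))"
  shows "real_to_rmax z \<in> halfspace c K"
proof -
  have "\<exists>i\<in>K. ereal (z $ j) - ereal (c $ j) \<le> ereal (z $ i) - ereal (c $ i)" if j: "j \<notin> K" for j
  \<comment> \<open>Whichever of \<open>y\<close> and the translate of \<open>a\<close> supplies
    \<open>z $ j\<close>, its own dominating index in \<open>K\<close> also works for
    \<open>z\<close>, since \<open>z\<close> lies above both.\<close>
  proof (cases "y $ j \<le> ereal (s + a $ j)")
    case True
    obtain i where i: "i \<in> K" "a $ j - c $ j \<le> a $ i - c $ i"
      using a K j by (auto simp: halfspace_iff real_to_rmax_def)
    have "z $ j = s + a $ j"
      using z[of j] True by (simp add: max_absorb2)
    moreover have "s + a $ i \<le> z $ i"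
      using z[of i] by (metis ereal_less_eq(3) max.cobounded2)
    ultimately show ?thesis
      using i by (intro bexI[of _ i]) auto
  next
    case False
    obtain i where i: "i \<in> K" "y $ j - ereal (c $ j) \<le> y $ i - ereal (c $ i)"
      using y K j by (auto simp: halfspace_iff)
    have "ereal (z $ j) = y $ j"
      using z[of j] False by (simp add: max_absorb1)
    moreover have "y $ i - ereal (c $ i) \<le> ereal (z $ i) - ereal (c $ i)"
      using z[of i] by (intro ereal_minus_mono) auto
    ultimately show ?thesis
      using i order_trans by metis
  qed
  then show ?thesis
    using K real_to_rmax_nonzero[of z] by (simp add: halfspace_iff real_to_rmax_def)
qed

lemma not_halfspace_sup_real:
  assumes K: "K \<noteq> {}" "K \<noteq> UNIV" and y: "y \<in> rmax_vecs - {rmax_zero}" "y \<notin> halfspace a K"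
  shows "\<exists>s z. (\<forall>i. ereal (z $ i) = max (y $ i) (ereal (s + a $ i))) \<and>
    real_to_rmax z \<notin> halfspace a K"
proof -
  obtain j where j: "j \<notin> K" "\<And>i. i \<in> K \<Longrightarrow> y $ i - ereal (a $ i) < y $ j - ereal (a $ j)"
    using y K by (auto simp: halfspace_iff not_le)
  have fin: "y $ i \<noteq> \<infinity>" for i
    using y by (simp add: rmax_vecs_def)
  obtain k where k: "k \<in> K" using K by blast
  obtain t where t: "y $ j = ereal t"
    using j(2)[OF k] fin[of j] by (cases "y $ j") auto
  \<comment> \<open>Relative to \<open>a\<close> the translate is constantly \<open>s\<close>, one
    below the value of \<open>y\<close> at \<open>j\<close>, so \<open>j\<close> still beats every
    index of \<open>K\<close>.\<close>
  define s where "s = t - a $ j - 1"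
  define z :: "real^'a" where "z = (\<chi> i. real_of_ereal (max (y $ i) (ereal (s + a $ i))))"
  have z: "ereal (z $ i) = max (y $ i) (ereal (s + a $ i))" for i
    using fin[of i] by (cases "y $ i") (auto simp: z_def max_def)
  have "z $ j = t"
    using z[of j] t by (auto simp: s_def max_def split: if_splits)
  have "z $ i - a $ i < z $ j - a $ j" if "i \<in> K" for i
    using z[of i] j(2)[OF that] fin[of i] t \<open>z $ j = t\<close>
    by (cases "y $ i") (auto simp: s_def max_def split: if_splits)
  then have "i \<notin> tight a z" if "i \<in> K" for i
    using that leD unfolding tight_def mem_Collect_eq by blast
  then have "real_to_rmax z \<notin> halfspace a K"
    using real_mem_halfspace_iff[OF K] by blast
  with z show ?thesis
    by blast
qed

text \<open>By minimality some \<open>H\<close> is no longer implied once the class of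
  \<open>a\<close> is removed from \<open>A\<close>. A point outside \<open>H\<close> in all
  remaining half-spaces must violate one at \<open>a\<close>, because the full set \<open>A\<close>
  implies \<open>H\<close>.\<close>

lemma nonredundant_not_covered:
  assumes p: "p \<ge> 1" and A: "is_nonredundant_apices v p A" and a: "to_proj a \<in> A"
  shows "\<exists>y. \<not> covered v p a y \<and> (\<forall>c. to_proj c \<in> A - {to_proj a} \<longrightarrow> covered v p c y)"
proof -
  let ?G = "\<lambda>X. \<Union>c\<in>X. halfspaces_at v p c"
  let ?Y = "A - {to_proj a}"
  have front: "tau' v p A = frontier (proj_cone v p)" "A \<subseteq> frontier (proj_cone v p)"
    and "tau' v p ?Y \<noteq> frontier (proj_cone v p)"
    using A a by (auto simp: is_nonredundant_apices_def)
  then obtain b where b: "b \<in> frontier (proj_cone v p)" "\<not> halfspaces_at v p b \<subseteq> tau v p (?G ?Y)"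
    by (auto simp: tau'_def)
  then obtain H where H: "H \<in> halfspaces_at v p b" "H \<notin> tau v p (?G ?Y)"
    by blast
  have "H \<in> tau v p (?G A)"
    using front b H by (auto simp: tau'_def)
  then have HA: "H \<in> halfspaces v p" "\<Inter>(?G A) \<subseteq> H"
    by (auto simp: tau_def split: if_splits)
  obtain y where y: "y \<in> rmax_vecs - {rmax_zero}" "y \<in> \<Inter>(?G ?Y)" "y \<notin> H"
  proof (cases "?G ?Y = {}")
    \<comment> \<open>Here \<open>tau\<close> is empty by convention and yields no separating point;
      one outside \<open>H\<close> is built by exceeding \<open>b'\<close> only off
      \<open>K\<close>.\<close>
    case True
    obtain b' K where K: "H = halfspace b' K" "K \<noteq> {}" "K \<noteq> UNIV"
      using H by (auto simp: halfspaces_at_def)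
    define x where "x = (\<chi> i. b' $ i + (if i \<in> K then 0 else 1))"
    have "tight b' x \<inter> K = {}"
      using K by (force simp: x_def tight_def)
    then have "real_to_rmax x \<notin> H"
      using K by (simp add: real_mem_halfspace_iff)
    then show thesis
      using that[of "real_to_rmax x"] True real_to_rmax_nonzero[of x] by auto
  next
    case False
    then have "tau v p (?G ?Y) = {H \<in> halfspaces v p. \<Inter>(?G ?Y) \<subseteq> H}"
      unfolding tau_def by (rule if_not_P)
    then obtain y where y: "y \<in> \<Inter>(?G ?Y)" "y \<notin> H"
      using H(2) HA(1) by blast
    obtain H0 where "H0 \<in> ?G ?Y"
      using False by blast
    then have "y \<in> H0" "\<exists>b K. H0 = halfspace b K"
      using y(1) by (blast, auto simp: halfspaces_at_def)
    then have "y \<in> rmax_vecs - {rmax_zero}"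
      unfolding halfspace_def by blast
    then show thesis
      by (rule that) fact+
  qed
  obtain H' where "H' \<in> ?G A" "y \<notin> H'"
    using HA(2) y(3) by blast
  then have "H' \<in> halfspaces_at v p (to_proj a)"
    using y(2) by blast
  then obtain a' K where a': "to_proj a' = to_proj a" "y \<notin> halfspace a' K"
    and K: "K \<noteq> {}" "K \<noteq> UNIV" "mp_cone v p - {rmax_zero} \<subseteq> halfspace a' K"
    using \<open>y \<notin> H'\<close> by (auto simp: halfspaces_at_def)
  obtain s z where z: "\<forall>i. ereal (z $ i) = max (y $ i) (ereal (s + a' $ i))"
    "real_to_rmax z \<notin> halfspace a' K"
    using not_halfspace_sup_real[OF K(1,2) y(1) a'(2)] by (elim exE conjE)
  have "\<not> covered v p a' z"
    unfolding covered_iff_halfspaces[OF p] using z(2) K by (metis (lifting))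
  then have "\<not> covered v p a z"
    using covered_cong[OF a'(1)] by simp
  moreover have "covered v p c z" if "to_proj c \<in> ?Y" for c
    unfolding covered_iff_halfspaces[OF p]
  proof (intro allI impI)
    fix K' :: "'a set"
    assume K': "K' \<noteq> {}" "K' \<noteq> UNIV" "mp_cone v p - {rmax_zero} \<subseteq> halfspace c K'"
    then have "halfspace c K' \<in> ?G ?Y"
      using that by (auto simp: halfspaces_at_def)
    then have "y \<in> halfspace c K'"
      using y(2) by blast
    moreover have "a' \<in> real_cone v p"
      using a'(1) a front(2) frontier_subset_proj_cone[of v p]
      by (auto simp flip: to_proj_mem_proj_cone_iff)
    then have "real_to_rmax a' \<in> halfspace c K'"
      using K'(3) real_to_rmax_nonzero[of a'] by (auto simp: real_to_rmax_mem_mp_cone_iff)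
    ultimately show "real_to_rmax z \<in> halfspace c K'"
      by (rule halfspace_sup_real[OF K'(1,2) _ _ z(1)[rule_format]])
  qed
  ultimately show ?thesis by blast
qed

section \<open>Perturbing an apex by lowering coordinates\<close>

definition lowered :: "real^'n \<Rightarrow> real \<Rightarrow> 'n set \<Rightarrow> real^'n" where
  "lowered a e L = (\<chi> i. a $ i - (if i \<in> L then e else 0))"

text \<open>Lowering the apex on \<open>L\<close> raises \<open>x - a\<close> there by
  \<open>e\<close>, so ties are broken in favour of \<open>L\<close>.\<close>

lemma tight_lowered:
  assumes "e > 0" "tight a x \<inter> L \<noteq> {}"
  shows "tight (lowered a e L) x = tight a x \<inter> L"
proof -
  obtain m where "m \<in> tight a x" "m \<in> L"
    using assms by blast
  then have m: "\<And>i. x $ i - a $ i \<le> x $ m - a $ m" "m \<in> L"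
    by (auto simp: tight_def)
  show ?thesis
  proof
    show "tight (lowered a e L) x \<subseteq> tight a x \<inter> L"
    proof
      fix k assume "k \<in> tight (lowered a e L) x"
      then have "x $ m - a $ m + e \<le> x $ k - a $ k + (if k \<in> L then e else 0)"
        using m(2) by (auto simp: tight_def lowered_def algebra_simps dest!: spec[of _ m])
      then have "k \<in> L" "x $ m - a $ m \<le> x $ k - a $ k"
        using m(1)[of k] assms(1) by (auto split: if_splits)
      with m(1) show "k \<in> tight a x \<inter> L"
        unfolding tight_def by (auto intro: order_trans)
    qed
    show "tight a x \<inter> L \<subseteq> tight (lowered a e L) x"
    proof
      fix k assume k: "k \<in> tight a x \<inter> L"
      have "x $ i - lowered a e L $ i \<le> x $ k - lowered a e L $ k" for i
      proof -
        have "x $ i - a $ i \<le> x $ k - a $ k"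
          using k by (simp add: tight_def)
        then show ?thesis
          using assms(1) k by (simp add: lowered_def)
      qed
      then show "k \<in> tight (lowered a e L) x"
        by (simp add: tight_def)
    qed
  qed
qed

text \<open>Indices of \<open>L\<close> gain \<open>e\<close>, which is within the gap: they can at
  most draw level with the old maximisers, hence only an inclusion.\<close>

lemma tight_subset_lowered:
  assumes "\<And>i j. i \<in> tight a x \<Longrightarrow> j \<notin> tight a x \<Longrightarrow> x $ j - a $ j + e \<le> x $ i - a $ i"
    and "e > 0" "tight a x \<inter> L = {}"
  shows "tight a x \<subseteq> tight (lowered a e L) x"
proof
  fix k assume k: "k \<in> tight a x"
  have "x $ i - lowered a e L $ i \<le> x $ k - a $ k" for i
  proof (cases "i \<in> tight a x")
    case True
    with k assms(3) show ?thesis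
      by (auto simp: lowered_def tight_def)
  next
    case False
    with k have "x $ i - a $ i + e \<le> x $ k - a $ k"
      using assms(1) by blast
    with assms(2) show ?thesis by (simp add: lowered_def)
  qed
  moreover have "k \<notin> L" using k assms(3) by blast
  ultimately show "k \<in> tight (lowered a e L) x"
    by (simp add: tight_def lowered_def)
qed

lemma tight_gap_uniform:
  obtains e where "e > 0"
    "\<And>r i j. r \<in> {1..p::nat} \<Longrightarrow> i \<in> tight a (v r) \<Longrightarrow> j \<notin> tight a (v r) \<Longrightarrow>
      v r $ j - a $ j + e \<le> v r $ i - a $ i"
proof -
  have "\<forall>r. \<exists>e>0. \<forall>i j. i \<in> tight a (v r) \<longrightarrow> j \<notin> tight a (v r) \<longrightarrow>
      v r $ j - a $ j + e \<le> v r $ i - a $ i"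
    using tight_gap by metis
  then obtain f where f: "\<And>r. f r > 0"
    "\<And>r i j. i \<in> tight a (v r) \<Longrightarrow> j \<notin> tight a (v r) \<Longrightarrow>
      v r $ j - a $ j + f r \<le> v r $ i - a $ i"
    by metis
  define e where "e = Min (insert 1 (f ` {1..p}))"
  have "e > 0"
    unfolding e_def using f(1) by (subst Min_gr_iff) auto
  moreover have "e \<le> f r" if "r \<in> {1..p}" for r
    unfolding e_def using that by (intro Min_le) auto
  ultimately show thesis
    using that[of e] f(2) add_left_mono order_trans by meson
qed

text \<open>Let \<open>D\<close> be maximal containing \<open>tight a y\<close> but no
  \<open>tight a (v r)\<close>, and \<open>I = - D\<close>. (C1) and (C2) hold since every such set
  meets \<open>I\<close>. (C4) needs, for each \<open>i\<close> in \<open>I\<close>, a generator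
  whose set contains \<open>j\<close> and meets \<open>I\<close> only in \<open>i\<close>; this is
  \<open>crit\<close>.\<close>

lemma vertex_of_not_covered:
  assumes a: "a \<in> real_cone v p" and e: "e > 0"
    "\<And>r i j. r \<in> {1..p} \<Longrightarrow> i \<in> tight a (v r) \<Longrightarrow> j \<notin> tight a (v r) \<Longrightarrow>
      v r $ j - a $ j + e \<le> v r $ i - a $ i"
    and y: "\<not> covered v p a y"
    and cov: "\<And>L. \<lbrakk>L \<noteq> {}; L \<noteq> UNIV; lowered a e L \<in> real_cone v p\<rbrakk> \<Longrightarrow>
      covered v p (lowered a e L) y"
  shows "\<exists>I j. I \<noteq> {} \<and> I \<noteq> UNIV \<and> j \<notin> I \<and> is_vertex v p I j (to_proj a)"
proof -
  define J where "J = tight a y"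
  let ?T = "\<lambda>r. tight a (v r)"
  let ?F = "{D. \<forall>r\<in>{1..p}. \<not> ?T r \<subseteq> D}"
  have "J \<in> ?F"
    using y by (auto simp: covered_def J_def)
  then obtain D where D: "D \<in> ?F" "J \<subseteq> D" and max: "\<And>E. E \<in> ?F \<Longrightarrow> D \<subseteq> E \<Longrightarrow> E = D"
    using finite_has_maximal2[OF finite \<open>J \<in> ?F\<close>] by (elim bexE conjE) blast
  obtain j where j: "j \<in> J"
    using tight_nonempty J_def by blast
  have crit: "\<exists>r\<in>{1..p}. ?T r \<subseteq> insert i D \<and> j \<in> ?T r" if i: "i \<notin> D" for i
  proof (rule ccontr)
    assume no: "\<not> ?thesis"
    \<comment> \<open>Lowering \<open>a\<close> off \<open>U\<close> stays in the cone, and being covered there yields a new set in the union.\<close>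
    define U where "U = \<Union>{?T r |r. r \<in> {1..p} \<and> ?T r \<subseteq> insert i D}"
    define L where "L = - U"
    have jL: "j \<in> L"
      using no by (auto simp: L_def U_def)
    have "insert i D \<notin> ?F"
      using max[of "insert i D"] i by blast
    then obtain r0 where "r0 \<in> {1..p}" "?T r0 \<subseteq> insert i D"
      by blast
    then have "?T r0 \<subseteq> U"
      by (auto simp: U_def)
    then have L: "L \<noteq> UNIV"
      using tight_nonempty[of a "v r0"] by (auto simp: L_def)
    have "lowered a e L \<in> real_cone v p"
      unfolding real_cone_def
    proof (intro CollectI allI)
      fix k
      show "\<exists>r\<in>{1..p}. k \<in> tight (lowered a e L) (v r)"
      \<comment> \<open>On \<open>L\<close> any generator tight at \<open>k\<close> stays tight. Off
        \<open>L\<close> the index \<open>k\<close> lies in a set inside \<open>U\<close>, which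
        misses \<open>L\<close> and so survives the perturbation.\<close>
      proof (cases "k \<in> L")
        case True
        obtain r where "r \<in> {1..p}" "k \<in> ?T r"
          using a by (rule real_coneE)
        then show ?thesis
          using tight_lowered[OF e(1), of a "v r" L] True by blast
      next
        case False
        then obtain r where r: "r \<in> {1..p}" "k \<in> ?T r" "?T r \<subseteq> U"
          by (auto simp: L_def U_def)
        then have "?T r \<inter> L = {}"
          by (auto simp: L_def)
        then show ?thesis
          using tight_subset_lowered[of a "v r" e L] e r by blast
      qed
    qed
    then have "covered v p (lowered a e L) y"
      using cov L jL by blast
    moreover have "tight (lowered a e L) y = J \<inter> L"
      using tight_lowered[OF e(1), of a y L] j jL by (auto simp: J_def)
    ultimately obtain r where r: "r \<in> {1..p}" "tight (lowered a e L) (v r) \<subseteq> J \<inter> L"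
      by (auto simp: covered_def)
    have TL: "?T r \<inter> L \<noteq> {}"
    proof
      assume "?T r \<inter> L = {}"
      then show False
        using tight_subset_lowered[of a "v r" e L] e r tight_nonempty[of a "v r"] by blast
    qed
    then have "?T r \<inter> L \<subseteq> J"
      using tight_lowered[OF e(1) TL] r by blast
    \<comment> \<open>The part in \<open>L\<close> lies in \<open>J\<close>, hence in
      \<open>D\<close>; the rest lies in \<open>U\<close>. So this set belongs to the union
      \<open>U\<close>, against \<open>TL\<close>.\<close>
    then have "?T r \<subseteq> insert i D"
      using D(2) by (auto simp: L_def U_def)
    then have "?T r \<subseteq> U"
      using r by (auto simp: U_def)
    with TL show False
      by (auto simp: L_def)
  qed
  have hit: "\<exists>i. i \<in> ?T r \<and> i \<notin> D" if "r \<in> {1..p}" for r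
    using D(1) that by blast
  have "\<exists>r. r \<in> {1..p}"
    using a real_coneE by metis
  then have "- D \<noteq> {}"
    using hit by blast
  moreover have "- D \<noteq> UNIV" "j \<notin> - D"
    using j D(2) by auto
  moreover have "is_vertex v p (- D) j (to_proj a)"
    unfolding is_vertex.abs_eq
  proof (intro conjI allI impI ballI)
    show "(\<Union>i\<in>- D. sector v p i a) = {1..p}"
      unfolding sector_eq_tight using hit by blast
  next
    fix k
    obtain r where "r \<in> {1..p}" "k \<in> ?T r"
      using a by (rule real_coneE)
    with hit show "\<exists>i\<in>- D. sector v p i a \<inter> sector v p k a \<noteq> {}"
      unfolding sector_eq_tight by blast
  next
    fix i assume i: "i \<in> - D"
    then obtain r where r: "r \<in> {1..p}" "?T r \<subseteq> insert i D" "j \<in> ?T r"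
      using crit by blast
    \<comment> \<open>No such set fits inside \<open>D\<close>, so the one extra index must
      occur.\<close>
    moreover have "i \<in> ?T r"
      using hit[OF r(1)] r(2) by blast
    ultimately show "\<not> sector v p i a \<inter> sector v p j a \<subseteq> (\<Union>k\<in>- D - {i}. sector v p k a)"
      unfolding sector_eq_tight by blast
  qed
  ultimately show ?thesis
    by (intro exI[of _ "- D"] exI[of _ j] conjI)
qed

theorem theorem7:
  fixes v :: "nat \<Rightarrow> real^'n" and p :: nat and A :: "'n tproj set" and a :: "'n tproj"
  assumes "is_nonredundant_apices v p A"
    and "a \<in> A"
  shows "\<exists>I j. I \<noteq> {} \<and> I \<noteq> UNIV \<and> j \<notin> I \<and> is_vertex v p I j a"
proof -
  obtain x where x: "a = to_proj x"
    by (metis Quotient3_abs_rep Quotient3_tproj)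
  have tau: "tau' v p A = frontier (proj_cone v p)"
    using assms by (simp add: is_nonredundant_apices_def)
  have xC: "x \<in> real_cone v p"
    using assms frontier_subset_proj_cone[of v p]
    by (auto simp: is_nonredundant_apices_def x simp flip: to_proj_mem_proj_cone_iff)
  then have p: "p \<ge> 1"
    by (fastforce simp: real_cone_def)
  have xA: "to_proj x \<in> A"
    using assms(2) x by simp
  let ?X = "{c. to_proj c \<in> A - {to_proj x}}"
  obtain y where y: "\<not> covered v p x y"
    "\<forall>c. to_proj c \<in> A - {to_proj x} \<longrightarrow> covered v p c y"
    using nonredundant_not_covered[OF p assms(1) xA] by (elim exE conjE)
  have yX: "\<forall>c\<in>?X. covered v p c y"
    using y(2) by simp
  obtain e where e: "e > 0"
    "\<And>r i j. r \<in> {1..p} \<Longrightarrow> i \<in> tight x (v r) \<Longrightarrow> j \<notin> tight x (v r) \<Longrightarrow>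
      v r $ j - x $ j + e \<le> v r $ i - x $ i"
    using tight_gap_uniform[of p x v] by blast
  let ?B = "{lowered x e L |L. L \<noteq> {} \<and> L \<noteq> UNIV \<and> lowered x e L \<in> real_cone v p}"
  \<comment> \<open>There are only finitely many index sets \<open>L\<close>.\<close>
  have finB: "finite ?B"
    by (rule finite_subset[of _ "range (lowered x e)"]) auto
  have B: "b \<in> real_cone v p \<and> to_proj b \<noteq> to_proj x" if b: "b \<in> ?B" for b
  proof -
    obtain L where L: "b = lowered x e L" "L \<noteq> {}" "L \<noteq> UNIV" "b \<in> real_cone v p"
      using b by blast
    obtain i k where "i \<in> L" "k \<notin> L" using L(2,3) by blast
    have "to_proj b \<noteq> to_proj x"
    proof
      assume "to_proj b = to_proj x"
      then obtain c where c: "b $ m = c + x $ m" for m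
        by (auto simp: to_proj_eq_iff)
      \<comment> \<open>The difference from \<open>x\<close> is \<open>-e\<close> at
        \<open>i\<close> and \<open>0\<close> at \<open>k\<close>, so it cannot be constant.\<close>
      show False
        using c[of i] c[of k] \<open>i \<in> L\<close> \<open>k \<notin> L\<close> e(1) by (simp add: L(1) lowered_def)
    qed
    with L show ?thesis by blast
  qed
  have cov: "covered v p b z"
    if b: "b \<in> real_cone v p" and z: "\<forall>c\<in>?X. covered v p c z" "covered v p x z" for b z
  proof (rule covered_of_tau'[OF p tau b])
    fix c assume c: "to_proj c \<in> A"
    show "covered v p c z"
    proof (cases "to_proj c = to_proj x")
      case True
      with z(2) show ?thesis
        using covered_cong by blast
    next
      case False
      with c show ?thesis
        by (intro z(1)[rule_format]) simp
    qed
  qed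
  \<comment> \<open>Exchanges the other non-redundant apices for the lowered points around
    \<open>x\<close>.\<close>
  have "\<exists>z. \<not> covered v p x z \<and> (\<forall>b\<in>?B. covered v p b z)"
    by (rule not_covered_avoiding_finite[OF xC finB ballI[OF B] y(1) yX cov])
  then obtain z where z: "\<not> covered v p x z" "\<forall>b\<in>?B. covered v p b z"
    by (elim exE conjE)
  have zL: "covered v p (lowered x e L) z"
    if "L \<noteq> {}" "L \<noteq> UNIV" "lowered x e L \<in> real_cone v p" for L
    using that by (intro z(2)[rule_format]) blast
  show ?thesis
    unfolding x by (rule vertex_of_not_covered[OF xC e z(1) zL])
qed

end
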